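(* Let $m$ be a nonzero integer, $m=\varepsilon p_1^{\alpha_1}p_2^{\alpha_2}\cdots p_r^{\alpha_r}$ with $\varepsilon=\pm1$, $p_1,\dots,p_r$ distinct positive primes and all $\alpha_i\ge 1$, and let $x$ be an integer. Let $p_{i_1},\dots,p_{i_t}$ be all the distinct primes which divide $x$ and $m$ simultaneously, put $d=p_{i_1}^{\alpha_{i_1}}\cdots p_{i_t}^{\alpha_{i_t}}$ and $m'=m/d$, and let $\delta=-1$ if $m\in A$ and $\delta=+1$ if $m\notin A$. If $(k_1^0,k_2^0)$ is a particular integer solution of the Diophantine equation $k_2m'-k_1d=\delta$ in the unknowns $k_1,k_2$, then $$L(x,m)\equiv \delta+k_1^0d\equiv k_2^0m' \pmod m .$$
   Context: $\varphi$ is Euler's totient function, with $\varphi(-k)=\varphi(k)$. For a nonzero integer $m$, $C_1,\dots,C_{\varphi(m)}$ denotes a reduced residue system modulo $m$ (representatives of all the residue classes modulo $m$ that are relatively prime to $m$), and $L(x,m)=\prod_{i=1}^{\varphi(m)}(x+C_i)$. $A$ is the set of integers $m$ such that $m=\pm p^\beta$ or $m=\pm 2p^\beta$ with $p$ an odd prime and $\beta\ge1$, or $m=\pm 2^\alpha$ with $\alpha\in\{0,1,2\}$, or $m=0$. An empty product equals $1$. *)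

theory Defs
  imports "HOL-Number_Theory.Number_Theory"
begin

definition phi :: "int \<Rightarrow> nat" where
  "phi m = totient (nat \<bar>m\<bar>)"

definition reduced_residue_system :: "int \<Rightarrow> (nat \<Rightarrow> int) \<Rightarrow> bool" where
  "reduced_residue_system m C \<longleftrightarrow>
     (\<forall>i\<in>{1..phi m}. coprime (C i) m) \<and>
     (\<forall>a. coprime a m \<longrightarrow> (\<exists>!i. i \<in> {1..phi m} \<and> [C i = a] (mod m)))"

text \<open>The value depends on the chosen system \<open>C\<close>; only its residue modulo \<open>m\<close> does not.\<close>

definition L :: "(nat \<Rightarrow> int) \<Rightarrow> int \<Rightarrow> int \<Rightarrow> int" where
  "L C x m = (\<Prod>i = 1..phi m. x + C i)"

definition A_set :: "int set" where
  "A_set = {m. (\<exists>p \<beta>. prime p \<and> odd p \<and> \<beta> \<ge> 1 \<and>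
                  (m = p ^ \<beta> \<or> m = - (p ^ \<beta>) \<or> m = 2 * p ^ \<beta> \<or> m = - (2 * p ^ \<beta>)))
             \<or> (\<exists>\<alpha>\<in>{0, 1, 2::nat}. m = 2 ^ \<alpha> \<or> m = - (2 ^ \<alpha>))
             \<or> m = 0}"

end

theory Submission
  imports Defs
begin

text \<open>
  Write \<open>m = d m'\<close> with \<open>d\<close> and \<open>m'\<close> coprime. Some \<open>C\<^sub>i\<close> is congruent to
  \<open>- x\<close> modulo \<open>m'\<close>, so \<open>L(x,m) \<equiv> 0\<close> modulo \<open>m'\<close>. Modulo \<open>d\<close>, replace \<open>x\<close> by
  \<open>y \<equiv> x\<close> (mod \<open>d\<close>), \<open>y \<equiv> 0\<close> (mod \<open>m'\<close>): every prime factor of \<open>m\<close> divides \<open>y\<close>, so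
  the \<open>y + C\<^sub>i\<close> form again a reduced residue system and the generalized Wilson theorem gives
  \<open>L(x,m) \<equiv> \<delta>\<close>.

  For Wilson's theorem, pair each unit \<open>u\<close> with \<open>h/u\<close>, where \<open>h\<close> is a unit that is not a
  square: the product of all units is \<open>h\<close> to the power \<open>\<phi>(n)/2\<close>. If \<open>n\<close> has a primitive root,
  take it for \<open>h\<close> and get \<open>-1\<close>; otherwise Carmichael's function divides \<open>\<phi>(n)/2\<close>, and the
  product is \<open>1\<close>.
\<close>

section \<open>Products of units modulo \<open>n\<close> by pairing\<close>

lemma prod_involution_cong:
  fixes S :: "nat set" and h n :: nat
  assumes fin: "finite S"
    and f: "\<And>x. x \<in> S \<Longrightarrow> f x \<in> S" "\<And>x. x \<in> S \<Longrightarrow> f (f x) = x"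
      "\<And>x. x \<in> S \<Longrightarrow> f x \<noteq> x"
    and h: "\<And>x. x \<in> S \<Longrightarrow> [x * f x = h] (mod n)"
  shows "[\<Prod>S = h ^ (card S div 2)] (mod n)"
proof -
  \<comment> \<open>Every pair \<open>{x, f x}\<close> has one smaller member, in \<open>S1\<close>,
    and one larger, in \<open>S2\<close>. Grouping the product by smaller members leaves one factor
    \<open>h\<close> per pair.\<close>
  define S1 S2 where "S1 = {x\<in>S. x < f x}" and "S2 = {x\<in>S. f x < x}"
  have S: "S = S1 \<union> S2" "S1 \<inter> S2 = {}" "finite S1" "finite S2"
    using fin f(3) by (auto simp: S1_def S2_def) (meson linorder_neqE_nat)
  have bij: "bij_betw f S1 S2"
    by (rule bij_betwI[where g = f]) (auto simp: S1_def S2_def f)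
  have "card S = 2 * card S1"
    using S bij_betw_same_card[OF bij] by (simp add: card_Un_disjoint)
  moreover have "\<Prod>S = (\<Prod>x\<in>S1. x * f x)"
    using S prod.reindex_bij_betw[OF bij, of "\<lambda>x. x"]
    by (simp add: prod.union_disjoint prod.distrib)
  moreover have "[(\<Prod>x\<in>S1. x * f x) = (\<Prod>x\<in>S1. h)] (mod n)"
    by (rule cong_prod) (auto simp: S1_def h)
  ultimately show ?thesis by simp
qed

text \<open>The bound excludes \<open>n = 1\<close>, where the only totative is 1 although every
  remainder is 0.\<close>

lemma mod_in_totatives_iff:
  fixes n x :: nat
  assumes "n > 1"
  shows "x mod n \<in> totatives n \<longleftrightarrow> coprime x n"
  using assms by (auto simp: in_totatives_iff intro!: Nat.gr0I)

lemma prod_totatives_nonsquare: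
  fixes n h :: nat
  assumes n: "n > 1" and h: "coprime h n" and nonsq: "\<And>y. \<not> [y * y = h] (mod n)"
  shows "[\<Prod>(totatives n) = h ^ (totient n div 2)] (mod n)"
proof -
  \<comment> \<open>\<open>f x\<close> is the quotient of \<open>h\<close> by \<open>x\<close> among
    the totatives. A fixed point would exhibit \<open>h\<close> as the square \<open>x * x\<close>,
    which \<open>nonsq\<close> rules out.\<close>
  define f where "f x = (THE y. y \<in> totatives n \<and> [x * y = h] (mod n))" for x
  have ex: "\<exists>!y. y \<in> totatives n \<and> [x * y = h] (mod n)" if x: "x \<in> totatives n" for x
  proof -
    have xn: "coprime x n" using x by (auto simp: in_totatives_iff)
    then obtain z where z: "[x * z = 1] (mod n)" using cong_solve_coprime_nat[of x n] by auto
    define y where "y = (z * h) mod n"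
    have "coprime z n" using cong_imp_coprime[OF cong_sym[OF z]] by simp
    hence "y \<in> totatives n" using n h by (simp add: y_def mod_in_totatives_iff)
    moreover have "[x * y = h] (mod n)"
      using cong_scalar_right[OF z, of h] by (simp add: y_def cong_def mod_mult_right_eq mult.assoc)
    moreover have "y1 = y2" if "y1 \<in> totatives n" "[x * y1 = h] (mod n)"
      "y2 \<in> totatives n" "[x * y2 = h] (mod n)" for y1 y2
    proof -
      have "[y1 = y2] (mod n)"
        using that xn by (metis cong_mult_lcancel_nat cong_sym cong_trans coprime_commute)
      moreover have "y1 < n" "y2 < n" using that n by (auto intro: totatives_less)
      ultimately show ?thesis by (simp add: cong_def)
    qed
    ultimately show ?thesis by blast
  qed
  have f: "f x \<in> totatives n" "[x * f x = h] (mod n)" if "x \<in> totatives n" for x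
    using theI'[OF ex[OF that]] by (auto simp: f_def)
  have ff: "f (f x) = x" if "x \<in> totatives n" for x
    unfolding f_def[of "f x"]
    by (rule the1_equality[OF ex]) (use f that in \<open>auto simp: mult.commute\<close>)
  have "[\<Prod>(totatives n) = h ^ (card (totatives n) div 2)] (mod n)"
    by (rule prod_involution_cong[where f = f]) (use f ff nonsq in \<open>auto, metis\<close>)
  thus ?thesis by (simp add: totient_def)
qed

text \<open>Squaring maps the finite set of units to itself but identifies 1 with
  \<open>n - 1\<close>, which differ because \<open>n > 2\<close>. Not being injective, it is not
  surjective either.\<close>

lemma ex_nonsquare_mod:
  fixes n :: nat
  assumes "n > 2"
  shows "\<exists>h. coprime h n \<and> (\<forall>y. \<not> [y * y = h] (mod n))"
proof -
  let ?f = "\<lambda>y. y * y mod n"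
  have sub: "?f ` totatives n \<subseteq> totatives n"
    using assms by (auto simp: mod_in_totatives_iff) (auto simp: in_totatives_iff)
  have "?f 1 = ?f (n - 1)"
  proof -
    have "(n - 1) * (n - 1) = (n - 2) * n + 1"
      using assms by (auto simp: less_iff_Suc_add)
    thus ?thesis by (simp only: mod_mult_self3) simp
  qed
  moreover have "1 \<in> totatives n" "n - 1 \<in> totatives n" "1 \<noteq> n - 1"
    using assms minus_one_in_totatives[of n] by auto
  ultimately have "\<not> inj_on ?f (totatives n)" by (metis (no_types, lifting) inj_on_def)
  hence "?f ` totatives n \<noteq> totatives n"
    using eq_card_imp_inj_on[of "totatives n" ?f] by auto
  with sub obtain h where h: "h \<in> totatives n" "h \<notin> ?f ` totatives n" by blast
  have "\<not> [y * y = h] (mod n)" for y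
  proof
    assume *: "[y * y = h] (mod n)"
    have hn: "coprime h n" "h < n" using h assms by (auto simp: in_totatives_iff intro: totatives_less)
    have "coprime (y * y) n" using * hn(1) by (metis cong_imp_coprime cong_sym)
    \<comment> \<open>The image only covers squares of totatives, so an arbitrary root
      \<open>y\<close> is first reduced modulo \<open>n\<close>.\<close>
    hence "y mod n \<in> totatives n"
      using assms by (simp add: mod_in_totatives_iff)
    moreover have "?f (y mod n) = h" using * hn by (simp add: cong_def mod_mult_eq)
    ultimately show False using h by blast
  qed
  thus ?thesis using h by (auto simp: in_totatives_iff)
qed

section \<open>Powers with exponent half the totient\<close>

lemma two_Carmichael_dvd_totient:
  assumes "n > 0" "n \<notin> cyclic_moduli"
  shows "2 * Carmichael n dvd totient n"
proof (cases "\<exists>k. n = 2 ^ k")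
  case True
  then obtain k where k: "n = 2 ^ k" by auto
  with assms have "k \<noteq> 0 \<and> k \<noteq> 1 \<and> k \<noteq> 2" by (auto simp: cyclic_moduli_def)
  \<comment> \<open>From exponent 3 on, the Carmichael value of \<open>2 ^ k\<close> is
    \<open>2 ^ (k - 2)\<close>, exactly half the totient.\<close>
  hence "k \<ge> 3" by auto
  then obtain j where "k = j + 3" using le_Suc_ex by (metis add.commute)
  thus ?thesis using k by (auto simp: Carmichael_twopow totient_prime_power)
next
  case False
  hence ex: "\<exists>p\<in>prime_factors n. p \<noteq> 2"
    using assms Ex_other_prime_factor[of n 2] by auto
  have "n \<noteq> 0" using assms by simp
  from divide_out_primepow_ex[OF this ex]
  obtain p k b where p: "p \<noteq> 2" "prime p" "\<not> p dvd b" "0 < k" "n = p ^ k * b"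
    by metis
  have "odd p" using p primes_dvd_imp_eq[of 2 p] by auto
  have coprime: "coprime (p ^ k) b" using p prime_imp_coprime by auto
  have "b \<noteq> 0" using p by (intro notI) auto
  \<comment> \<open>The cofactors 1 and 2 would make \<open>n\<close> a cyclic modulus. Hence
    \<open>b > 2\<close>, which is what forces its Carmichael value to be even.\<close>
  moreover have "b \<noteq> 1" using p \<open>odd p\<close> assms by (auto simp: cyclic_moduli_def)
  moreover have "b \<noteq> 2"
  proof
    assume "b = 2"
    hence "n = 2 * p ^ k" using p by simp
    thus False using p \<open>odd p\<close> assms unfolding cyclic_moduli_def by blast
  qed
  ultimately have "even (Carmichael b)" by (intro even_Carmichael) linarith
  moreover have "even (Carmichael (p ^ k))"
    using p \<open>odd p\<close> by (simp add: Carmichael_prime_power)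
  \<comment> \<open>The Carmichael value of a coprime product is the lcm of the two values. Both
    being even, the lcm falls short of their product by the gcd, which supplies the factor
    2.\<close>
  ultimately have "2 dvd gcd (Carmichael (p ^ k)) (Carmichael b)" by simp
  hence "2 * lcm (Carmichael (p ^ k)) (Carmichael b) dvd
      gcd (Carmichael (p ^ k)) (Carmichael b) * lcm (Carmichael (p ^ k)) (Carmichael b)"
    by (rule mult_dvd_mono) simp
  also have "\<dots> = Carmichael (p ^ k) * Carmichael b" by (rule prod_gcd_lcm_nat [symmetric])
  also have "\<dots> dvd totient (p ^ k) * totient b"
    by (intro mult_dvd_mono Carmichael_dvd_totient)
  finally show ?thesis
    using coprime p by (simp add: Carmichael_mult_coprime totient_mult_coprime)
qed

text \<open>A primitive root satisfies \<open>g ^ j = -1\<close> for some \<open>j\<close> below the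
  totient. Squaring shows that the order, here the totient, divides \<open>2 * j\<close>, and the
  range of \<open>j\<close> leaves only half the totient.\<close>

lemma residue_primroot_power_half:
  assumes n: "n > 2" and g: "residue_primroot n g"
  shows "[g ^ (totient n div 2) = n - 1] (mod n)"
proof -
  have "bij_betw (\<lambda>i. g ^ i mod n) {..<totient n} (totatives n)"
    using n g by (intro residue_primroot_is_generator) auto
  moreover have "n - 1 \<in> totatives n" using n minus_one_in_totatives[of n] by auto
  ultimately obtain j where j: "j < totient n" "g ^ j mod n = n - 1"
    unfolding bij_betw_def by (metis (no_types, lifting) imageE lessThan_iff)
  \<comment> \<open>Exponent 0 would give \<open>1 = n - 1\<close>, impossible for
    \<open>n > 2\<close>.\<close>
  have j0: "j \<noteq> 0" using j n by (intro notI) auto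
  have "(n - 1) * (n - 1) = (n - 2) * n + 1"
    using n by (auto simp: less_iff_Suc_add)
  hence "[(n - 1) * (n - 1) = 1] (mod n)" unfolding cong_def by (simp only: mod_mult_self3)
  moreover have "[g ^ j = n - 1] (mod n)" using j n by (simp add: cong_def)
  ultimately have "[g ^ (2 * j) = 1] (mod n)"
    unfolding mult_2 power_add by (meson cong_mult cong_trans)
  hence "totient n dvd 2 * j"
    using g ord_divides[of g "2 * j" n] by (auto simp: residue_primroot_def)
  then obtain c where c: "2 * j = totient n * c" by blast
  have "c = 1"
  proof -
    have "totient n * c < totient n * 2" using c j by linarith
    hence "c < 2" by simp
    moreover have "c \<noteq> 0" using c j0 by (intro notI) auto
    ultimately show ?thesis by linarith
  qed
  with c have "totient n div 2 = j" by simp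
  thus ?thesis using j n by (simp add: cong_def)
qed

theorem wilson_generalized:
  assumes "n > 0"
  shows "[int (\<Prod>(totatives n)) = (if n \<in> cyclic_moduli then -1 else 1)] (mod int n)"
proof -
  \<comment> \<open>Pairing needs an even number of units. The moduli 1 and 2 have a single one, but
    there -1 and 1 agree.\<close>
  consider "n = 1" | "n = 2" | "n > 2" using assms by linarith
  thus ?thesis
  proof cases
    case 1
    thus ?thesis by simp
  next
    case 2
    have "{0<..<2} = {1::nat}" by auto
    hence "totatives 2 = {1}" using totatives_prime[OF two_is_prime_nat] by simp
    thus ?thesis using 2 by (simp add: cong_def)
  next
    case 3
    hence n1: "n > 1" by simp
    have even: "2 * (totient n div 2) = totient n" using totient_even[OF 3] by simp
    show ?thesis
    proof (cases "n \<in> cyclic_moduli")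
      case True
      then obtain g where g: "residue_primroot n g"
        using residue_primroot_iff_in_cyclic_moduli by blast
      hence ord: "coprime n g" "ord n g = totient n" by (auto simp: residue_primroot_def)
      \<comment> \<open>If \<open>g\<close> were the square of \<open>y\<close>, Euler's theorem for
        \<open>y\<close> would make the order of \<open>g\<close> divide half the totient.\<close>
      have nonsq: "\<not> [y * y = g] (mod n)" for y
      proof
        assume *: "[y * y = g] (mod n)"
        hence "coprime (y * y) n" using ord by (metis cong_imp_coprime cong_sym coprime_commute)
        hence "[y ^ totient n = 1] (mod n)" by (intro euler_theorem) simp
        moreover have "[y ^ totient n = g ^ (totient n div 2)] (mod n)"
          using cong_pow[OF *, of "totient n div 2"] even
          by (metis power2_eq_square power_mult)
        ultimately have "[g ^ (totient n div 2) = 1] (mod n)" by (meson cong_sym cong_trans)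
        hence "totient n dvd totient n div 2" using ord ord_divides by metis
        moreover have "totient n > 0" using 3 by simp
        ultimately show False using even by (auto dest: dvd_imp_le)
      qed
      have "[\<Prod>(totatives n) = n - 1] (mod n)"
        using prod_totatives_nonsquare[of n g] residue_primroot_power_half[OF 3 g] nonsq ord n1
        by (meson cong_trans coprime_commute)
      hence "[int (\<Prod>(totatives n)) = int (n - 1)] (mod int n)"
        by (simp only: cong_int_iff)
      also have "[int (n - 1) = -1] (mod int n)"
        using 3 by (simp add: cong_iff_dvd_diff of_nat_diff)
      finally show ?thesis using True by simp
    next
      case False
      obtain h where h: "coprime h n" "\<And>y. \<not> [y * y = h] (mod n)"
        using ex_nonsquare_mod[OF 3] by blast
      obtain c where "totient n = 2 * Carmichael n * c"
        using two_Carmichael_dvd_totient[OF assms False] by blast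
      hence "totient n div 2 = Carmichael n * c" by simp
      moreover have "[h ^ Carmichael n = 1] (mod n)"
        using h 3 by (intro power_Carmichael_eq_1) (auto simp: coprime_commute)
      ultimately have "[h ^ (totient n div 2) = 1] (mod n)"
        using cong_pow[of "h ^ Carmichael n" 1 n c] by (simp add: power_mult)
      hence "[\<Prod>(totatives n) = 1] (mod n)"
        using prod_totatives_nonsquare[of n h] h n1 by (meson cong_trans)
      thus ?thesis using False cong_int_iff[of "\<Prod>(totatives n)" 1 n] by simp
    qed
  qed
qed

section \<open>Transfer to integer moduli and arbitrary reduced residue systems\<close>

lemma A_set_iff_cyclic_moduli:
  assumes "m \<noteq> 0"
  shows "m \<in> A_set \<longleftrightarrow> nat \<bar>m\<bar> \<in> cyclic_moduli"
proof
  assume "m \<in> A_set"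
  then consider p \<beta> where "prime p" "odd p" "\<beta> \<ge> 1" "\<bar>m\<bar> = p ^ \<beta> \<or> \<bar>m\<bar> = 2 * p ^ \<beta>"
    | "\<bar>m\<bar> \<in> {1, 2, 4}"
    using assms unfolding A_set_def by (auto simp: abs_mult power_abs prime_ge_0_int)
  thus "nat \<bar>m\<bar> \<in> cyclic_moduli"
  proof cases
    case 1
    from \<open>prime p\<close> have p: "p \<ge> 0" "prime (nat p)" by (auto simp: prime_ge_0_int)
    have "odd (nat p)" using \<open>odd p\<close> p by (simp add: even_nat_iff)
    moreover have "nat \<bar>m\<bar> = nat p ^ \<beta> \<or> nat \<bar>m\<bar> = 2 * nat p ^ \<beta>"
      using 1(4) p by (auto simp: nat_mult_distrib nat_power_eq)
    ultimately show ?thesis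
      using p \<open>\<beta> \<ge> 1\<close> less_le_trans[OF zero_less_one]
      unfolding cyclic_moduli_def by blast
  next
    case 2
    thus ?thesis by (auto simp: cyclic_moduli_def)
  qed
next
  assume "nat \<bar>m\<bar> \<in> cyclic_moduli"
  then consider p k where "prime p" "odd p" "k > 0" "nat \<bar>m\<bar> = p ^ k \<or> nat \<bar>m\<bar> = 2 * p ^ k"
    | "nat \<bar>m\<bar> \<in> {1, 2, 4}"
    unfolding cyclic_moduli_def by auto
  thus "m \<in> A_set"
  proof cases
    case 1
    have "\<bar>m\<bar> = int p ^ k \<or> \<bar>m\<bar> = 2 * int p ^ k"
      using 1(4) by (metis abs_ge_zero int_nat_eq of_nat_mult of_nat_numeral of_nat_power)
    hence "m = int p ^ k \<or> m = - (int p ^ k) \<or> m = 2 * int p ^ k \<or> m = - (2 * int p ^ k)"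
      by linarith
    moreover have "prime (int p)" "odd (int p)" "k \<ge> 1" using 1 by auto
    ultimately show ?thesis unfolding A_set_def by blast
  next
    case 2
    hence "m \<in> {2 ^ 0, - (2 ^ 0), 2 ^ 1, - (2 ^ 1), 2 ^ 2, - (2 ^ 2)}" by auto
    thus ?thesis unfolding A_set_def by blast
  qed
qed

text \<open>Sending each totative to an index whose representative is congruent to it is injective.
  Both sides have \<open>phi m\<close> elements, so it is a bijection and the products agree factor
  by factor.\<close>

lemma prod_reduced_residue_system:
  assumes m: "m \<noteq> 0" and C: "reduced_residue_system m C"
  shows "[(\<Prod>i = 1..phi m. C i) = int (\<Prod>(totatives (nat \<bar>m\<bar>)))] (mod m)"
proof -
  let ?T = "totatives (nat \<bar>m\<bar>)"
  have "\<exists>i. i \<in> {1..phi m} \<and> [C i = int t] (mod m)" if "t \<in> ?T" for t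
  proof -
    have "coprime t (nat \<bar>m\<bar>)" using that by (simp add: in_totatives_iff)
    hence "coprime (int t) (int (nat \<bar>m\<bar>))" by (simp only: coprime_int_iff)
    hence "coprime (int t) m" by simp
    thus ?thesis using C unfolding reduced_residue_system_def by blast
  qed
  then obtain f where f: "\<And>t. t \<in> ?T \<Longrightarrow> f t \<in> {1..phi m}"
    "\<And>t. t \<in> ?T \<Longrightarrow> [C (f t) = int t] (mod m)" by metis
  have "inj_on f ?T"
  proof
    fix s t assume st: "s \<in> ?T" "t \<in> ?T" "f s = f t"
    hence "[int s = int t] (mod m)" using f by (metis cong_sym cong_trans)
    hence "m dvd int s - int t" by (simp add: cong_iff_dvd_diff)
    \<comment> \<open>Totatives lie between 1 and the absolute value of \<open>m\<close>, so two of
      them cannot differ by a nonzero multiple of \<open>m\<close>.\<close>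
    moreover have "\<bar>int s - int t\<bar> < \<bar>m\<bar>"
      using st by (auto simp: in_totatives_iff)
    ultimately show "s = t" using dvd_imp_le_int[of "int s - int t" m] by fastforce
  qed
  moreover have "f ` ?T = {1..phi m}"
    using calculation f(1)
    by (intro card_subset_eq) (auto simp: card_image phi_def totient_def)
  ultimately have "bij_betw f ?T {1..phi m}" by (simp add: bij_betw_def)
  hence "(\<Prod>i = 1..phi m. C i) = (\<Prod>t\<in>?T. C (f t))" by (simp add: prod.reindex_bij_betw)
  also have "[\<dots> = (\<Prod>t\<in>?T. int t)] (mod m)" using f by (intro cong_prod) auto
  finally show ?thesis by simp
qed

section \<open>Shifts by a multiple of every prime factor of the modulus\<close>

lemma coprime_add_iff_radical_dvd:
  fixes m x c :: int
  assumes "\<And>q. prime q \<Longrightarrow> q dvd m \<Longrightarrow> q dvd x" and "m \<noteq> 0"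
  shows "coprime (x + c) m \<longleftrightarrow> coprime c m"
proof -
  \<comment> \<open>Coprimality to \<open>m\<close> can be tested at each prime of \<open>m\<close>.
    Such a prime divides \<open>x\<close>, so it divides \<open>x + c\<close> exactly when it
    divides \<open>c\<close>.\<close>
  have "coprime a m \<longleftrightarrow> (\<forall>q. prime q \<longrightarrow> q dvd m \<longrightarrow> \<not> q dvd a)" for a :: int
  proof -
    have "gcd a m \<noteq> 0" using assms(2) by simp
    hence "coprime a m \<longleftrightarrow> (\<nexists>q. prime q \<and> q dvd gcd a m)"
      using prime_divisor_exists[of "gcd a m"] not_prime_unit dvd_trans
      unfolding is_unit_gcd_iff [symmetric] is_unit_gcd [symmetric] by blast
    thus ?thesis by auto
  qed
  thus ?thesis using assms(1) by (simp add: dvd_add_right_iff cong: imp_cong)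
qed

text \<open>The shifted system reaches \<open>a\<close> at the index where \<open>C\<close> reaches
  \<open>a - x\<close>, which is a unit together with \<open>a\<close>.\<close>

lemma reduced_residue_system_shift:
  assumes C: "reduced_residue_system m C" and m: "m \<noteq> 0"
    and x: "\<And>q. prime q \<Longrightarrow> q dvd m \<Longrightarrow> q dvd x"
  shows "reduced_residue_system m (\<lambda>i. x + C i)"
proof -
  note cop = coprime_add_iff_radical_dvd[OF x m]
  have "\<exists>!i. i \<in> {1..phi m} \<and> [x + C i = a] (mod m)" if "coprime a m" for a
  proof -
    have "coprime (a - x) m" using cop[of "a - x"] that by simp
    moreover have "[x + C i = a] (mod m) \<longleftrightarrow> [C i = a - x] (mod m)" for i
      by (simp add: cong_iff_dvd_diff algebra_simps)
    ultimately show ?thesis using C unfolding reduced_residue_system_def by simp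
  qed
  thus ?thesis using C cop unfolding reduced_residue_system_def by simp
qed

lemma L_cong_of_radical_dvd:
  assumes "reduced_residue_system m C" "m \<noteq> 0"
    and "\<And>q. prime q \<Longrightarrow> q dvd m \<Longrightarrow> q dvd x"
  shows "[L C x m = (if m \<in> A_set then -1 else 1)] (mod m)"
proof -
  have "[L C x m = int (\<Prod>(totatives (nat \<bar>m\<bar>)))] (mod m)"
    unfolding L_def
    by (rule prod_reduced_residue_system[OF _ reduced_residue_system_shift]) (use assms in auto)
  moreover have "[int (\<Prod>(totatives (nat \<bar>m\<bar>))) = (if m \<in> A_set then -1 else 1)] (mod m)"
    using wilson_generalized[of "nat \<bar>m\<bar>"] assms(2)
    unfolding A_set_iff_cyclic_moduli[OF assms(2)] by (simp add: cong_iff_dvd_diff)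
  ultimately show ?thesis by (rule cong_trans)
qed

section \<open>Splitting the modulus and gluing the congruences\<close>

lemma L_cong_mod_coprime_factors:
  fixes d e x :: int
  assumes C: "reduced_residue_system (d * e) C" and nz: "d * e \<noteq> 0" and cop: "coprime d e"
    and d: "\<And>q. prime q \<Longrightarrow> q dvd d \<Longrightarrow> q dvd x" and e: "coprime x e"
  shows "[L C x (d * e) = (if d * e \<in> A_set then -1 else 1)] (mod d)"
    and "e dvd L C x (d * e)"
proof -
  obtain y where y: "[y = x] (mod d)" "[y = 0] (mod e)"
    using binary_chinese_remainder_int[OF cop] by blast
  have "q dvd y" if "prime q" "q dvd d * e" for q
  proof -
    from that consider "q dvd d" | "q dvd e" using prime_dvd_mult_iff by blast
    thus ?thesis
    proof cases
      case 1
      hence "q dvd x" using d that by blast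
      thus ?thesis using y(1) 1 by (metis cong_dvd_iff cong_dvd_modulus)
    next
      case 2
      thus ?thesis using y(2) by (metis cong_0_iff dvd_trans)
    qed
  qed
  \<comment> \<open>The sign belongs to the whole modulus \<open>d * e\<close>, so Wilson's theorem
    is applied there and reduced to \<open>d\<close> only afterwards.\<close>
  hence "[L C y (d * e) = (if d * e \<in> A_set then -1 else 1)] (mod d * e)"
    using L_cong_of_radical_dvd[OF C nz] by blast
  hence "[L C y (d * e) = (if d * e \<in> A_set then -1 else 1)] (mod d)"
    by (rule cong_dvd_modulus) simp
  moreover have "[L C x (d * e) = L C y (d * e)] (mod d)"
    unfolding L_def using y(1) by (intro cong_prod cong_add cong_refl) (rule cong_sym)
  ultimately show "[L C x (d * e) = (if d * e \<in> A_set then -1 else 1)] (mod d)"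
    by (meson cong_trans)
next
  \<comment> \<open>The residue 1 modulo \<open>d\<close> makes \<open>c\<close> a unit modulo
    \<open>d * e\<close>, so that some \<open>C i\<close> represents it.\<close>
  obtain c where c: "[c = 1] (mod d)" "[c = - x] (mod e)"
    using binary_chinese_remainder_int[OF cop] by blast
  have "coprime c d" using c(1) by (metis cong_imp_coprime cong_sym coprime_1_left)
  moreover have "coprime c e"
    using c(2) e by (metis cong_imp_coprime cong_sym coprime_minus_left_iff)
  ultimately obtain i where i: "i \<in> {1..phi (d * e)}" "[C i = c] (mod d * e)"
    using C unfolding reduced_residue_system_def by (meson coprime_mult_right_iff)
  have "[C i = c] (mod e)" using i(2) by (rule cong_dvd_modulus) simp
  hence "[C i = - x] (mod e)" using c(2) by (rule cong_trans)
  hence "e dvd x + C i" by (simp add: cong_iff_dvd_diff add.commute)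
  also have "x + C i dvd L C x (d * e)" unfolding L_def using i(1) by (intro dvd_prodI) auto
  finally show "e dvd L C x (d * e)" .
qed

theorem mainTheorem5:
  fixes m x \<epsilon> d m' \<delta> k1 k2 :: int
    and r :: nat
    and p :: "nat \<Rightarrow> int"
    and \<alpha> :: "nat \<Rightarrow> nat"
    and C :: "nat \<Rightarrow> int"
  assumes "m \<noteq> 0"
    and "\<epsilon> = 1 \<or> \<epsilon> = -1"
    and "\<And>i. i \<in> {1..r} \<Longrightarrow> prime (p i)"
    and "inj_on p {1..r}"
    and "\<And>i. i \<in> {1..r} \<Longrightarrow> \<alpha> i \<ge> 1"
    and "m = \<epsilon> * (\<Prod>i = 1..r. p i ^ \<alpha> i)"
    and "reduced_residue_system m C"
    and "d = (\<Prod>i \<in> {i \<in> {1..r}. p i dvd x \<and> p i dvd m}. p i ^ \<alpha> i)"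
    and "m' = m div d"
    and "\<delta> = (if m \<in> A_set then -1 else 1)"
    and "k2 * m' - k1 * d = \<delta>"
  shows "[L C x m = \<delta> + k1 * d] (mod m) \<and> [\<delta> + k1 * d = k2 * m'] (mod m)"
proof -
  define I J where "I = {i \<in> {1..r}. p i dvd x \<and> p i dvd m}" and "J = {1..r} - I"
  \<comment> \<open>The sign goes into \<open>e\<close>, so that \<open>m = d * e\<close> holds
    exactly and \<open>e\<close> is the quotient \<open>m'\<close>.\<close>
  define e where "e = \<epsilon> * (\<Prod>i\<in>J. p i ^ \<alpha> i)"
  have d: "d = (\<Prod>i\<in>I. p i ^ \<alpha> i)" using assms(8) by (simp add: I_def)
  have IJ: "{1..r} = I \<union> J" "I \<inter> J = {}" "finite I" "finite J" by (auto simp: I_def J_def)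
  have m: "m = d * e"
    unfolding assms(6) d e_def IJ(1) using IJ(2-4) by (simp add: prod.union_disjoint)
  have m': "m' = e" using assms(1,9) m by auto
  have p_dvd: "p i dvd m" if "i \<in> {1..r}" for i
  proof -
    have "p i dvd p i ^ \<alpha> i" using assms(5)[OF that] by (simp add: dvd_power)
    also have "\<dots> dvd (\<Prod>i = 1..r. p i ^ \<alpha> i)" using that by (intro dvd_prodI) auto
    finally show ?thesis using assms(6) by simp
  qed
  have unit: "coprime a \<epsilon>" for a using assms(2) by auto
  have "coprime (p i) (p j)" if "i \<in> I" "j \<in> J" for i j
    using that IJ assms(3,4) by (intro primes_coprime) (auto dest: inj_onD)
  hence cop: "coprime d e"
    unfolding d e_def using unit by (auto intro!: prod_coprime_left prod_coprime_right)
  have rad: "q dvd x" if "prime q" "q dvd d" for q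
  proof -
    from that obtain i where i: "i \<in> I" "q dvd p i"
      unfolding d using IJ(3) by (auto simp: prime_dvd_prod_iff dest: prime_dvd_power)
    thus ?thesis by (auto simp: I_def)
  qed
  have "coprime x (p j)" if "j \<in> J" for j
  proof -
    have "\<not> p j dvd x" "prime (p j)" using that p_dvd assms(3) by (auto simp: I_def J_def)
    thus ?thesis using prime_imp_coprime coprime_commute by blast
  qed
  hence xe: "coprime x e"
    unfolding e_def using unit by (auto intro!: prod_coprime_right)
  have eq: "\<delta> + k1 * d = k2 * e" using assms(11) m' by simp
  note L = L_cong_mod_coprime_factors[OF _ _ cop rad xe, of C, folded m]
  have "[L C x m = \<delta>] (mod d)" using L(1) assms(1,7,10) by simp
  \<comment> \<open>The Diophantine equation makes \<open>\<delta> + k1 * d\<close> and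
    \<open>k2 * e\<close> the same integer. The first form shows that it is \<delta> modulo
    \<open>d\<close>, the second that it is 0 modulo \<open>e\<close>.\<close>
  hence "d dvd L C x m - \<delta> - k1 * d" by (simp add: cong_iff_dvd_diff)
  moreover have "e dvd L C x m - k2 * e" using L(2) assms(1,7) by simp
  ultimately have "m dvd L C x m - k2 * e"
    unfolding m using cop eq by (intro divides_mult) (simp_all add: algebra_simps)
  thus ?thesis using eq m' by (simp add: cong_iff_dvd_diff)
qed

end
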